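(* Let $\mathcal{X}$ and $\mathcal{Y}$ be Banach spaces and let $A\in\mathcal{L}(\mathcal{X},\mathcal{Y})$ and closed subspaces $\mathcal{T}\subseteq\mathcal{X}$, $\mathcal{S}\subseteq\mathcal{Y}$ be such that $A^{(2)}_{\mathcal{T},\mathcal{S}}$ exists. Let $(A_n)_{n\in\mathbb{N}}\subset\mathcal{L}(\mathcal{X},\mathcal{Y})$ and let $(\mathcal{T}_n)_{n\in\mathbb{N}}$ and $(\mathcal{S}_n)_{n\in\mathbb{N}}$ be sequences of closed subspaces of $\mathcal{X}$ and $\mathcal{Y}$, respectively, such that $(A_n)^{(2)}_{\mathcal{T}_n,\mathcal{S}_n}$ exists for each $n\in\mathbb{N}$. Suppose, in addition, that there exist hermitian idempotents $U,U_n\in\mathcal{L}(\mathcal{X})$ and $V,V_n\in\mathcal{L}(\mathcal{Y})$ ($n\in\mathbb{N}$) such that $\mathcal{R}(U)=\mathcal{T}$, $\mathcal{R}(U_n)=\mathcal{T}_n$, $\mathcal{N}(V)=\mathcal{S}$ and $\mathcal{N}(V_n)=\mathcal{S}_n$ for all $n\in\mathbb{N}$. If $(A_n)_{n\in\mathbb{N}}$ converges to $A$, then the following statements are equivalent (limits as $n\to\infty$, in operator norm; $I$ denotes the identity operator on the appropriate space). (i) $(A_n)^{(2)}_{\mathcal{T}_n,\mathcal{S}_n}\to A^{(2)}_{\mathcal{T},\mathcal{S}}$. (ii) $(A_n)^{(2)}_{\mathcal{T}_n,\mathcal{S}_n}A_n\to A^{(2)}_{\mathcal{T},\mathcal{S}}A$,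 $V(I-V_n)\to0$ and $V_n(I-V)\to0$. (iii) $A_n(A_n)^{(2)}_{\mathcal{T}_n,\mathcal{S}_n}\to AA^{(2)}_{\mathcal{T},\mathcal{S}}$, $(I-U)U_n\to0$ and $(I-U_n)U\to0$. (iv) $V(I-V_n)\to0$, $V_n(I-V)\to0$, $(I-U)U_n\to0$ and $(I-U_n)U\to0$.
   Context: For $A\in\mathcal{L}(\mathcal{X},\mathcal{Y})$ (bounded linear operators) and closed subspaces $\mathcal{T}\subseteq\mathcal{X}$, $\mathcal{S}\subseteq\mathcal{Y}$, the outer inverse $A^{(2)}_{\mathcal{T},\mathcal{S}}$ is the (necessarily unique, if it exists) operator $B\in\mathcal{L}(\mathcal{Y},\mathcal{X})$ with $BAB=B$, range $\mathcal{R}(B)=\mathcal{T}$ and null space $\mathcal{N}(B)=\mathcal{S}$. An element $z$ of a unital Banach algebra is hermitian if $\|\exp(itz)\|=1$ for all $t\in\mathbb{R}$. *)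

theory Defs
  imports "HOL-Analysis.Analysis"
begin

text \<open>
  Hermitian elements are defined through \<open>exp (\<i> t z)\<close>, so the Banach spaces are complex.
  A complex Banach space is a Banach space of the library with a compatible complex scalar
  multiplication. The remaining module axiom \<open>1 *\<^sub>C x = x\<close> follows from \<open>scaleR_scaleC\<close>.
\<close>

class complex_normed_vector = real_normed_vector +
  fixes scaleC :: "complex \<Rightarrow> 'a \<Rightarrow> 'a" (infixr \<open>*\<^sub>C\<close> 75)
  assumes scaleC_add_right: "c *\<^sub>C (x + y) = c *\<^sub>C x + c *\<^sub>C y"
    and scaleC_add_left: "(c + d) *\<^sub>C x = c *\<^sub>C x + d *\<^sub>C x"
    and scaleC_scaleC: "c *\<^sub>C (d *\<^sub>C x) = (c * d) *\<^sub>C x"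
    and scaleR_scaleC: "r *\<^sub>R x = complex_of_real r *\<^sub>C x"
    and norm_scaleC: "norm (c *\<^sub>C x) = cmod c * norm x"

class complex_banach = complex_normed_vector + banach

instantiation complex :: complex_banach
begin

definition scaleC_complex :: "complex \<Rightarrow> complex \<Rightarrow> complex" where
  "scaleC_complex c x = c * x"

instance
  by standard (auto simp: scaleC_complex_def algebra_simps norm_mult scaleR_conv_of_real)

end

lemma bounded_linear_scaleC: "bounded_linear (\<lambda>x::'a::complex_normed_vector. c *\<^sub>C x)"
proof (rule bounded_linear_intro)
  fix r and x y :: 'a
  show "c *\<^sub>C (x + y) = c *\<^sub>C x + c *\<^sub>C y"
    by (rule scaleC_add_right)
  show "c *\<^sub>C (r *\<^sub>R x) = r *\<^sub>R (c *\<^sub>C x)"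
    by (simp add: scaleR_scaleC scaleC_scaleC mult.commute)
  show "norm (c *\<^sub>C x) \<le> norm x * cmod c"
    by (simp add: norm_scaleC mult.commute)
qed

instantiation blinfun :: (real_normed_vector, complex_normed_vector) complex_normed_vector
begin

lift_definition scaleC_blinfun :: "complex \<Rightarrow> 'a \<Rightarrow>\<^sub>L 'b \<Rightarrow> 'a \<Rightarrow>\<^sub>L 'b"
  is "\<lambda>c f x. c *\<^sub>C f x"
  by (rule bounded_linear_compose[OF bounded_linear_scaleC])

instance
proof
  fix c d :: complex and r :: real and f g :: "'a \<Rightarrow>\<^sub>L 'b"
  show "c *\<^sub>C (f + g) = c *\<^sub>C f + c *\<^sub>C g"
    by transfer (simp add: scaleC_add_right)
  show "(c + d) *\<^sub>C f = c *\<^sub>C f + d *\<^sub>C f"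
    by transfer (simp add: scaleC_add_left)
  show "c *\<^sub>C (d *\<^sub>C f) = (c * d) *\<^sub>C f"
    by transfer (simp add: scaleC_scaleC)
  show "r *\<^sub>R f = complex_of_real r *\<^sub>C f"
    by transfer (simp add: scaleR_scaleC)
  show "norm (c *\<^sub>C f) = cmod c * norm f"
  proof -
    have "bounded_linear (blinfun_apply f)"
      by (rule blinfun.bounded_linear_right)
    then have "onorm (\<lambda>x. cmod c *\<^sub>R f x) = cmod c * onorm f"
      by (subst onorm_scaleR) auto
    then show ?thesis
      by transfer (simp add: onorm_def norm_scaleC)
  qed
qed

end

instance blinfun :: (real_normed_vector, complex_banach) complex_banach ..

text \<open>
  \<open>'x \<Rightarrow>\<^sub>L 'y\<close> consists of all bounded real-linear maps; \<open>clin_ops\<close> is the space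
  \<open>\<L>(X, Y)\<close> of bounded complex-linear ones, with the same operator norm.
\<close>

definition clin_ops :: "('x::complex_normed_vector \<Rightarrow>\<^sub>L 'y::complex_normed_vector) set" where
  "clin_ops = {f. \<forall>c x. blinfun_apply f (c *\<^sub>C x) = c *\<^sub>C blinfun_apply f x}"

definition closed_csubspace :: "'x::complex_normed_vector set \<Rightarrow> bool" where
  "closed_csubspace S \<longleftrightarrow> closed S \<and> subspace S \<and> (\<forall>c. \<forall>x\<in>S. c *\<^sub>C x \<in> S)"

definition null_space :: "('x::real_normed_vector \<Rightarrow>\<^sub>L 'y::real_normed_vector) \<Rightarrow> 'x set" where
  "null_space f = {x. blinfun_apply f x = 0}"

definition is_outer_inverse ::
  "('x::complex_normed_vector \<Rightarrow>\<^sub>L 'y::complex_normed_vector) \<Rightarrow> 'x set \<Rightarrow> 'y set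
     \<Rightarrow> ('y \<Rightarrow>\<^sub>L 'x) \<Rightarrow> bool" where
  "is_outer_inverse A T S B \<longleftrightarrow>
     B \<in> clin_ops \<and> B o\<^sub>L A o\<^sub>L B = B \<and> range (blinfun_apply B) = T \<and> null_space B = S"

lemma is_outer_inverse_unique:
  assumes B: "is_outer_inverse A T S B" and C: "is_outer_inverse A T S C"
  shows "B = C"
proof (rule blinfun_eqI)
  fix y
  have BAB: "B (A (B z)) = B z" for z
    using B unfolding is_outer_inverse_def by (metis blinfun_apply_blinfun_compose)
  have CAC: "C (A (C z)) = C z" for z
    using C unfolding is_outer_inverse_def by (metis blinfun_apply_blinfun_compose)
  have "y - A (B y) \<in> null_space B"
    by (simp add: null_space_def blinfun.diff_right BAB)
  then have "y - A (B y) \<in> null_space C"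
    using B C by (simp add: is_outer_inverse_def)
  then have 1: "C y = C (A (B y))"
    by (simp add: null_space_def blinfun.diff_right)
  have "B y \<in> range C"
    using B C by (auto simp: is_outer_inverse_def)
  then have "C (A (B y)) = B y"
    using CAC by auto
  with 1 show "B y = C y" by simp
qed

definition outer_inverse_exists ::
  "('x::complex_normed_vector \<Rightarrow>\<^sub>L 'y::complex_normed_vector) \<Rightarrow> 'x set \<Rightarrow> 'y set \<Rightarrow> bool" where
  "outer_inverse_exists A T S \<longleftrightarrow> (\<exists>B. is_outer_inverse A T S B)"

definition outer_inverse ::
  "('x::complex_normed_vector \<Rightarrow>\<^sub>L 'y::complex_normed_vector) \<Rightarrow> 'x set \<Rightarrow> 'y set
     \<Rightarrow> ('y \<Rightarrow>\<^sub>L 'x)" where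
  "outer_inverse A T S = (THE B. is_outer_inverse A T S B)"

lemma is_outer_inverse_outer_inverse:
  assumes "outer_inverse_exists A T S"
  shows "is_outer_inverse A T S (outer_inverse A T S)"
proof -
  obtain B where B: "is_outer_inverse A T S B"
    using assms unfolding outer_inverse_exists_def by blast
  then show ?thesis
    unfolding outer_inverse_def by (rule theI) (rule is_outer_inverse_unique[OF _ B])
qed

text \<open>
  The library constants \<open>exp\<close> and \<open>(^)\<close> are not available on \<open>'x \<Rightarrow>\<^sub>L 'x\<close>, which is not an
  instance of the algebra classes, so the exponential is given by its power series.
\<close>

primrec blinfun_pow :: "('x::real_normed_vector \<Rightarrow>\<^sub>L 'x) \<Rightarrow> nat \<Rightarrow> ('x \<Rightarrow>\<^sub>L 'x)" where
  "blinfun_pow F 0 = id_blinfun"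
| "blinfun_pow F (Suc n) = F o\<^sub>L blinfun_pow F n"

definition blinfun_exp :: "('x::banach \<Rightarrow>\<^sub>L 'x) \<Rightarrow> ('x \<Rightarrow>\<^sub>L 'x)" where
  "blinfun_exp F = (\<Sum>n. blinfun_pow F n /\<^sub>R fact n)"

lemma norm_blinfun_pow_le: "norm (blinfun_pow F n) \<le> norm F ^ n"
proof (induction n)
  case 0
  show ?case by (rule norm_blinfun_bound) simp_all
next
  case (Suc n)
  have "norm (blinfun_pow F (Suc n)) \<le> norm F * norm (blinfun_pow F n)"
    by (simp add: norm_blinfun_compose)
  also have "\<dots> \<le> norm F * norm F ^ n"
    using Suc.IH by (intro mult_left_mono) simp_all
  finally show ?case by simp
qed

lemma summable_blinfun_exp:
  fixes F :: "'x::banach \<Rightarrow>\<^sub>L 'x"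
  shows "summable (\<lambda>n. blinfun_pow F n /\<^sub>R fact n)"
proof (rule summable_comparison_test')
  show "summable (\<lambda>n. norm F ^ n /\<^sub>R fact n)"
    by (rule summable_exp_generic)
  show "norm (blinfun_pow F n /\<^sub>R fact n) \<le> norm F ^ n /\<^sub>R fact n" if "0 \<le> n" for n
    by (simp add: norm_blinfun_pow_le divide_simps)
qed

text \<open>Hermitian elements of the unital Banach algebra \<open>\<L>(X)\<close>, and those that are idempotent.\<close>

definition hermitian :: "('x::complex_banach \<Rightarrow>\<^sub>L 'x) \<Rightarrow> bool" where
  "hermitian F \<longleftrightarrow> F \<in> clin_ops \<and>
     (\<forall>t::real. norm (blinfun_exp ((\<i> * complex_of_real t) *\<^sub>C F)) = 1)"

definition hermitian_idempotent :: "('x::complex_banach \<Rightarrow>\<^sub>L 'x) \<Rightarrow> bool" where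
  "hermitian_idempotent F \<longleftrightarrow> hermitian F \<and> F o\<^sub>L F = F"

end

theory Submission
  imports Defs
begin

text \<open>
  A hermitian idempotent \<open>U\<close> satisfies \<open>exp (\<i> \<pi> U) = I - 2 U\<close>, hence has norm at most 1, and this
  uniform bound is the only consequence of hermiticity that is needed. Write \<open>B\<close>, \<open>B\<^sub>n\<close> for the outer
  inverses. The identities \<open>V A B = V\<close>, \<open>B V = B\<close>, \<open>B A U = U\<close>, \<open>U B = B\<close> exhibit each of the four
  gap operators as a product of bounded factors with \<open>B\<^sub>n A\<^sub>n - B A\<close> or with
  \<open>A\<^sub>n B\<^sub>n - A B\<close>. Conversely
  \<open>B\<^sub>n - B = B\<^sub>n V\<^sub>n (I - V) (I - A B) + B\<^sub>n (A - A\<^sub>n) B - (I - B\<^sub>n A\<^sub>n) (I - U\<^sub>n) U B\<close>,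
  so \<open>\<parallel>B\<^sub>n - B\<parallel> \<le> \<epsilon>\<^sub>n (1 + \<parallel>B\<^sub>n\<parallel>)\<close> with \<open>\<epsilon>\<^sub>n \<longlonglongrightarrow> 0\<close>, which forces \<open>B\<^sub>n \<longlonglongrightarrow> B\<close>.
\<close>

section \<open>Exponentials of scaled idempotents and the norm bound for hermitian ones\<close>

lemma scaleC_minus_one: "(-1) *\<^sub>C x = - (x :: 'a::complex_normed_vector)"
  using scaleR_scaleC[of "-1" x] by simp

lemma scaleC_one: "1 *\<^sub>C x = (x :: 'a::complex_normed_vector)"
  using scaleR_scaleC[of 1 x] by simp

lemma bounded_linear_scaleC_left: "bounded_linear (\<lambda>c. c *\<^sub>C (x :: 'a::complex_normed_vector))"
  by (rule bounded_linear_intro[where K = "norm x"])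
    (simp_all add: scaleC_add_left scaleR_scaleC scaleC_scaleC norm_scaleC scaleC_complex_def)

text \<open>Idempotence collapses the powers of \<open>F\<close>, and complex linearity moves the
  scalars to the front. The exponent starts at one because the zeroth power is the identity, not
  \<open>F\<close>.\<close>

lemma blinfun_pow_scaleC_idempotent:
  assumes "F \<in> clin_ops" and "F o\<^sub>L F = F"
  shows "blinfun_pow (c *\<^sub>C F) (Suc n) = c ^ Suc n *\<^sub>C F"
proof (induction n)
  case 0
  show ?case by (rule blinfun_eqI) simp
next
  case (Suc n)
  have FF: "F (F x) = F x" for x
    using assms(2) by (metis blinfun_apply_blinfun_compose)
  have "blinfun_pow (c *\<^sub>C F) (Suc (Suc n)) = (c *\<^sub>C F) o\<^sub>L (c ^ Suc n *\<^sub>C F)"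
    using Suc.IH by simp
  also have "\<dots> = c ^ Suc (Suc n) *\<^sub>C F"
    using assms(1)
    by (intro blinfun_eqI) (simp add: scaleC_blinfun.rep_eq scaleC_scaleC clin_ops_def FF mult.assoc)
  finally show ?case .
qed

lemma blinfun_exp_scaleC_idempotent:
  fixes F :: "'x::complex_banach \<Rightarrow>\<^sub>L 'x"
  assumes "F \<in> clin_ops" and "F o\<^sub>L F = F"
  shows "blinfun_exp (c *\<^sub>C F) = exp c *\<^sub>C F + (id_blinfun - F)"
proof -
  have "(\<lambda>n. c ^ n /\<^sub>R fact n) sums exp c"
    by (rule exp_converges)
  then have "(\<lambda>n. (c ^ n /\<^sub>R fact n) *\<^sub>C F) sums (exp c *\<^sub>C F)"
    by (rule bounded_linear.sums[OF bounded_linear_scaleC_left])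
  \<comment> \<open>At index 0 the scalar series contributes \<open>F\<close> where the operator
    series has the identity; this one-term series supplies the difference.\<close>
  moreover have "(\<lambda>n. if n = 0 then id_blinfun - F else 0) sums (id_blinfun - F)"
    by (rule sums_single)
  ultimately have "(\<lambda>n. (c ^ n /\<^sub>R fact n) *\<^sub>C F + (if n = 0 then id_blinfun - F else 0))
      sums (exp c *\<^sub>C F + (id_blinfun - F))"
    by (rule sums_add)
  moreover have "(c ^ n /\<^sub>R fact n) *\<^sub>C F + (if n = 0 then id_blinfun - F else 0) =
      blinfun_pow (c *\<^sub>C F) n /\<^sub>R fact n" for n
  proof (cases n)
    case 0
    then show ?thesis by (simp add: scaleC_one)
  next
    case (Suc m)
    show ?thesis
      unfolding Suc blinfun_pow_scaleC_idempotent[OF assms]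
      by (simp add: scaleR_scaleC scaleC_scaleC scaleC_complex_def mult.assoc)
  qed
  ultimately show ?thesis
    unfolding blinfun_exp_def by (simp add: sums_iff)
qed

lemma norm_hermitian_idempotent_le:
  assumes "hermitian_idempotent U"
  shows "norm U \<le> 1"
proof -
  have U: "U \<in> clin_ops" "U o\<^sub>L U = U"
    and "norm (blinfun_exp ((\<i> * complex_of_real pi) *\<^sub>C U)) = 1"
    using assms by (auto simp: hermitian_idempotent_def hermitian_def)
  then have *: "norm (- U + (id_blinfun - U)) = 1"
    by (simp add: blinfun_exp_scaleC_idempotent scaleC_minus_one mult.commute[of \<i>])
  \<comment> \<open>This writes \<open>2 U\<close> as a difference of two operators of norm at most
    1.\<close>
  have "2 *\<^sub>R U = id_blinfun - (- U + (id_blinfun - U))"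
    by (simp add: scaleR_2)
  then have "norm (2 *\<^sub>R U) \<le> norm (id_blinfun :: 'a \<Rightarrow>\<^sub>L 'a) + 1"
    using norm_triangle_ineq4[of id_blinfun "- U + (id_blinfun - U)"] * by simp
  moreover have "norm (id_blinfun :: 'a \<Rightarrow>\<^sub>L 'a) \<le> 1"
    by (rule norm_blinfun_bound) simp_all
  ultimately show ?thesis by simp
qed

section \<open>Products of null sequences with bounded ones\<close>

lemma tendsto_blinfun_compose_zero_left:
  assumes "X \<longlonglongrightarrow> 0" and "Bseq Y"
  shows "(\<lambda>n. X n o\<^sub>L Y n) \<longlonglongrightarrow> 0"
  using bounded_bilinear.Zfun_prod_Bfun[OF bounded_bilinear_blinfun_compose] assms
  by (simp add: tendsto_Zfun_iff)

lemma tendsto_blinfun_compose_zero_right: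
  assumes "Bseq X" and "Y \<longlonglongrightarrow> 0"
  shows "(\<lambda>n. X n o\<^sub>L Y n) \<longlonglongrightarrow> 0"
  using bounded_bilinear.Bfun_prod_Zfun[OF bounded_bilinear_blinfun_compose] assms
  by (simp add: tendsto_Zfun_iff)

section \<open>Outer inverses against projections with the same range or null space\<close>

lemma is_outer_inverse_apply:
  assumes "is_outer_inverse A T S B"
  shows "B (A (B y)) = B y"
  using assms unfolding is_outer_inverse_def by (metis blinfun_apply_blinfun_compose)

text \<open>Both \<open>B A\<close> and \<open>U\<close> are idempotents with range
  \<open>T\<close>, so each fixes what the other produces.\<close>

lemma outer_inverse_range_projection:
  assumes "is_outer_inverse A T S B" and "U o\<^sub>L U = U" and "range (blinfun_apply U) = T"
  shows "B (A (U x)) = U x" and "U (B y) = B y"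
proof -
  have R: "range (blinfun_apply B) = range (blinfun_apply U)"
    using assms by (simp add: is_outer_inverse_def)
  then obtain z where "U x = B z" by blast
  then show "B (A (U x)) = U x"
    using is_outer_inverse_apply[OF assms(1)] by simp
  from R obtain w where "B y = U w" by blast
  then show "U (B y) = B y"
    using assms(2) by (metis blinfun_apply_blinfun_compose)
qed

text \<open>The vectors \<open>y - A (B y)\<close> and \<open>y - V y\<close> lie in the null spaces
  of \<open>B\<close> and \<open>V\<close> respectively, and these coincide.\<close>

lemma outer_inverse_null_projection:
  assumes "is_outer_inverse A T S B" and "V o\<^sub>L V = V" and "null_space V = S"
  shows "V (A (B y)) = V y" and "B (V y) = B y"
proof -
  have N: "V z = 0 \<longleftrightarrow> B z = 0" for z
    using assms by (auto simp: is_outer_inverse_def null_space_def)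
  have "B (y - A (B y)) = 0"
    by (simp add: blinfun.diff_right is_outer_inverse_apply[OF assms(1)])
  then show "V (A (B y)) = V y"
    using N[of "y - A (B y)"] by (simp add: blinfun.diff_right)
  have "V (V y) = V y"
    using assms(2) by (metis blinfun_apply_blinfun_compose)
  then show "B (V y) = B y"
    using N[of "y - V y"] by (simp add: blinfun.diff_right)
qed

text \<open>Since \<open>B' V' = B'\<close> and \<open>V A B = V\<close>, the first summand is
  \<open>B' - B' A B\<close>; the second turns this into \<open>B' - B' A' B\<close>. Since
  \<open>B' A' U' = U'\<close> and \<open>U B = B\<close>, the last term is
  \<open>B - B' A' B\<close>.\<close>

lemma outer_inverse_diff:
  assumes "is_outer_inverse A T S B" and "U o\<^sub>L U = U" and "range (blinfun_apply U) = T"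
    and "V o\<^sub>L V = V" and "null_space V = S"
    and "is_outer_inverse A' T' S' B'" and "U' o\<^sub>L U' = U'" and "range (blinfun_apply U') = T'"
    and "V' o\<^sub>L V' = V'" and "null_space V' = S'"
  shows "B' - B = (B' o\<^sub>L (V' o\<^sub>L (id_blinfun - V)) o\<^sub>L (id_blinfun - (A o\<^sub>L B)))
    + (B' o\<^sub>L (A - A') o\<^sub>L B)
    - ((id_blinfun - (B' o\<^sub>L A')) o\<^sub>L ((id_blinfun - U') o\<^sub>L U) o\<^sub>L B)"
  by (rule blinfun_eqI)
    (simp add: blinfun.bilinear_simps outer_inverse_range_projection[OF assms(1-3)]
      outer_inverse_null_projection[OF assms(1,4,5)] outer_inverse_range_projection[OF assms(6-8)]
      outer_inverse_null_projection[OF assms(6,9,10)])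

text \<open>An absorption argument: bound \<open>norm (X n)\<close> by
  \<open>norm L + norm (X n - L)\<close>; once \<open>e n < 1 / 2\<close>, the part with
  \<open>norm (X n - L)\<close> moves to the left at the cost of a factor 2.\<close>

lemma tendsto_of_norm_diff_le_self:
  fixes X :: "nat \<Rightarrow> 'a::real_normed_vector"
  assumes "e \<longlonglongrightarrow> 0" and "\<And>n. norm (X n - L) \<le> e n * (1 + norm (X n))"
  shows "X \<longlonglongrightarrow> L"
proof -
  have "\<forall>\<^sub>F n in sequentially. e n < 1 / 2"
    by (rule order_tendstoD(2)[OF assms(1)]) simp
  then have "\<forall>\<^sub>F n in sequentially. norm (X n - L) \<le> 2 * e n * (1 + norm L)"
  proof eventually_elim
    case (elim n)
    \<comment> \<open>The sign of \<open>e n\<close> is read off from the bound itself, which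
      dominates a norm and has a positive second factor.\<close>
    have "0 \<le> e n * (1 + norm (X n))"
      using assms(2)[of n] norm_ge_zero[of "X n - L"] by linarith
    then have "0 \<le> e n"
      by (smt (verit) mult_neg_pos norm_ge_zero)
    have "e n * norm (X n) \<le> e n * (norm L + norm (X n - L))"
      using \<open>0 \<le> e n\<close> norm_triangle_sub[of "X n" L] by (simp add: mult_left_mono)
    moreover have "e n * norm (X n - L) \<le> 1 / 2 * norm (X n - L)"
      using elim by (intro mult_right_mono) simp_all
    ultimately show ?case
      using assms(2)[of n] by (simp add: algebra_simps)
  qed
  moreover have "(\<lambda>n. 2 * e n * (1 + norm L)) \<longlonglongrightarrow> 0"
    by (rule tendsto_eq_intros assms(1) refl | simp)+
  ultimately have "(\<lambda>n. X n - L) \<longlonglongrightarrow> 0"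
    by (rule Lim_null_comparison)
  then show ?thesis
    by (simp add: LIM_zero_iff)
qed

text \<open>Each term of the decomposition grows at most linearly in \<open>norm B'\<close>. Pulling
  out \<open>1 + norm B'\<close> leaves a factor free of \<open>B'\<close>, as the absorption
  argument requires.\<close>

lemma norm_outer_inverse_diff_le:
  assumes "is_outer_inverse A T S B" and "U o\<^sub>L U = U" and "range (blinfun_apply U) = T"
    and "V o\<^sub>L V = V" and "null_space V = S"
    and "is_outer_inverse A' T' S' B'" and "U' o\<^sub>L U' = U'" and "range (blinfun_apply U') = T'"
    and "V' o\<^sub>L V' = V'" and "null_space V' = S'"
  shows "norm (B' - B) \<le> (norm (V' o\<^sub>L (id_blinfun - V)) * norm (id_blinfun - (A o\<^sub>L B))
      + norm (A - A') * norm B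
      + (1 + norm A') * norm ((id_blinfun - U') o\<^sub>L U) * norm B) * (1 + norm B')"
    (is "_ \<le> (?w * ?p + ?d * ?b + (1 + ?a) * ?g * ?b) * (1 + ?c)")
proof -
  have 1: "norm (B' o\<^sub>L (V' o\<^sub>L (id_blinfun - V)) o\<^sub>L (id_blinfun - (A o\<^sub>L B))) \<le> ?c * ?w * ?p"
    by (meson norm_blinfun_compose mult_right_mono norm_ge_zero order_trans)
  have 2: "norm (B' o\<^sub>L (A - A') o\<^sub>L B) \<le> ?c * ?d * ?b"
    by (meson norm_blinfun_compose mult_right_mono norm_ge_zero order_trans)
  have "norm (id_blinfun :: 'a \<Rightarrow>\<^sub>L 'a) \<le> 1"
    by (rule norm_blinfun_bound) simp_all
  then have "norm (id_blinfun - (B' o\<^sub>L A')) \<le> 1 + ?c * ?a"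
    using norm_triangle_ineq4[of id_blinfun "B' o\<^sub>L A'"] norm_blinfun_compose[of B' A'] by linarith
  then have 3: "norm ((id_blinfun - (B' o\<^sub>L A')) o\<^sub>L ((id_blinfun - U') o\<^sub>L U) o\<^sub>L B)
      \<le> (1 + ?c * ?a) * ?g * ?b"
    by (meson norm_blinfun_compose mult_right_mono norm_ge_zero order_trans)
  have "norm (B' - B) \<le> ?c * ?w * ?p + ?c * ?d * ?b + (1 + ?c * ?a) * ?g * ?b"
    unfolding outer_inverse_diff[OF assms]
    by (rule order_trans[OF norm_triangle_ineq4] order_trans[OF norm_triangle_ineq] add_mono 1 2 3)+
  also have "\<dots> \<le> (?w * ?p + ?d * ?b + (1 + ?a) * ?g * ?b) * (1 + ?c)"
  proof -
    \<comment> \<open>Exactly the surplus of the right side over the left after expansion.\<close>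
    have "0 \<le> ?w * ?p + ?d * ?b + ?a * ?g * ?b + ?c * ?g * ?b" by simp
    then show ?thesis by (simp add: algebra_simps)
  qed
  finally show ?thesis .
qed

theorem theorem7p2:
  fixes A :: "'x::complex_banach \<Rightarrow>\<^sub>L 'y::complex_banach"
    and As :: "nat \<Rightarrow> 'x \<Rightarrow>\<^sub>L 'y"
    and T :: "'x set" and Ts :: "nat \<Rightarrow> 'x set"
    and S :: "'y set" and Ss :: "nat \<Rightarrow> 'y set"
    and U :: "'x \<Rightarrow>\<^sub>L 'x" and Us :: "nat \<Rightarrow> 'x \<Rightarrow>\<^sub>L 'x"
    and V :: "'y \<Rightarrow>\<^sub>L 'y" and Vs :: "nat \<Rightarrow> 'y \<Rightarrow>\<^sub>L 'y"
  assumes "A \<in> clin_ops" and "\<And>n. As n \<in> clin_ops"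
    and "closed_csubspace T" and "closed_csubspace S"
    and "\<And>n. closed_csubspace (Ts n)" and "\<And>n. closed_csubspace (Ss n)"
    and "outer_inverse_exists A T S"
    and "\<And>n. outer_inverse_exists (As n) (Ts n) (Ss n)"
    and "hermitian_idempotent U" and "\<And>n. hermitian_idempotent (Us n)"
    and "hermitian_idempotent V" and "\<And>n. hermitian_idempotent (Vs n)"
    and "range (blinfun_apply U) = T" and "\<And>n. range (blinfun_apply (Us n)) = Ts n"
    and "null_space V = S" and "\<And>n. null_space (Vs n) = Ss n"
    and "As \<longlonglongrightarrow> A"
  shows "let
    i = ((\<lambda>n. outer_inverse (As n) (Ts n) (Ss n)) \<longlonglongrightarrow> outer_inverse A T S);
    ii = (
      (\<lambda>n. outer_inverse (As n) (Ts n) (Ss n) o\<^sub>L As n) \<longlonglongrightarrow> (outer_inverse A T S o\<^sub>L A) \<and>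
      (\<lambda>n. V o\<^sub>L (id_blinfun - Vs n)) \<longlonglongrightarrow> 0 \<and>
      (\<lambda>n. Vs n o\<^sub>L (id_blinfun - V)) \<longlonglongrightarrow> 0);
    iii = (
      (\<lambda>n. As n o\<^sub>L outer_inverse (As n) (Ts n) (Ss n)) \<longlonglongrightarrow> (A o\<^sub>L outer_inverse A T S) \<and>
      (\<lambda>n. (id_blinfun - U) o\<^sub>L Us n) \<longlonglongrightarrow> 0 \<and>
      (\<lambda>n. (id_blinfun - Us n) o\<^sub>L U) \<longlonglongrightarrow> 0);
    iv = (
      (\<lambda>n. V o\<^sub>L (id_blinfun - Vs n)) \<longlonglongrightarrow> 0 \<and>
      (\<lambda>n. Vs n o\<^sub>L (id_blinfun - V)) \<longlonglongrightarrow> 0 \<and>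
      (\<lambda>n. (id_blinfun - U) o\<^sub>L Us n) \<longlonglongrightarrow> 0 \<and>
      (\<lambda>n. (id_blinfun - Us n) o\<^sub>L U) \<longlonglongrightarrow> 0)
    in (i \<longleftrightarrow> ii) \<and> (i \<longleftrightarrow> iii) \<and> (i \<longleftrightarrow> iv)"
proof -
  define B where "B = outer_inverse A T S"
  define Bs where "Bs n = outer_inverse (As n) (Ts n) (Ss n)" for n
  have B: "is_outer_inverse A T S B" and Bs: "is_outer_inverse (As n) (Ts n) (Ss n) (Bs n)" for n
    using assms(7,8) by (simp_all add: B_def Bs_def is_outer_inverse_outer_inverse)
  have idem: "U o\<^sub>L U = U" "V o\<^sub>L V = V" "Us n o\<^sub>L Us n = Us n" "Vs n o\<^sub>L Vs n = Vs n" for n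
    using assms(9-12) by (simp_all add: hermitian_idempotent_def)
  note apply_simps = blinfun.bilinear_simps
    outer_inverse_range_projection[OF B idem(1) assms(13)]
    outer_inverse_null_projection[OF B idem(2) assms(15)]
    outer_inverse_range_projection[OF Bs idem(3) assms(14)]
    outer_inverse_null_projection[OF Bs idem(4) assms(16)]
  \<comment> \<open>Hermiticity enters here: the projections are uniformly bounded, so multiplying a
    null sequence by them keeps it null.\<close>
  have bU: "Bseq Us" and bV: "Bseq Vs"
    using assms(10,12) norm_hermitian_idempotent_le by (blast intro: BseqI')+
  have bU': "Bseq (\<lambda>n. id_blinfun - Us n)" and bV': "Bseq (\<lambda>n. id_blinfun - Vs n)"
    using Bseq_add[of "\<lambda>n. - Us n" id_blinfun] Bseq_add[of "\<lambda>n. - Vs n" id_blinfun] bU bV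
    by (simp_all add: Bseq_minus_iff)
  note As = \<open>As \<longlonglongrightarrow> A\<close>
  note compose = bounded_bilinear.tendsto[OF bounded_bilinear_blinfun_compose]
  note null_compose = tendsto_blinfun_compose_zero_left tendsto_blinfun_compose_zero_right

  have BA: "(\<lambda>n. Bs n o\<^sub>L As n) \<longlonglongrightarrow> (B o\<^sub>L A)" and AB: "(\<lambda>n. As n o\<^sub>L Bs n) \<longlonglongrightarrow> (A o\<^sub>L B)" if "Bs \<longlonglongrightarrow> B"
    using that As by (auto intro: compose)

  \<comment> \<open>The factorization rests on \<open>(I - U) B = 0\<close> and
    \<open>Bs n As n Us n = Us n\<close>; \<open>U2\<close> exchanges the roles of the limit and the
    sequence.\<close>
  have U1: "(\<lambda>n. (id_blinfun - U) o\<^sub>L Us n) \<longlonglongrightarrow> 0" if BA: "(\<lambda>n. Bs n o\<^sub>L As n) \<longlonglongrightarrow> (B o\<^sub>L A)"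
  proof -
    have "(id_blinfun - U) o\<^sub>L Us n = ((id_blinfun - U) o\<^sub>L ((Bs n o\<^sub>L As n) - (B o\<^sub>L A))) o\<^sub>L Us n" for n
      by (rule blinfun_eqI) (simp add: apply_simps)
    moreover have "(\<lambda>n. ((id_blinfun - U) o\<^sub>L ((Bs n o\<^sub>L As n) - (B o\<^sub>L A))) o\<^sub>L Us n) \<longlonglongrightarrow> 0"
      using BA bU by (intro null_compose) (simp_all add: LIM_zero)
    ultimately show ?thesis by simp
  qed
  have U2: "(\<lambda>n. (id_blinfun - Us n) o\<^sub>L U) \<longlonglongrightarrow> 0" if BA: "(\<lambda>n. Bs n o\<^sub>L As n) \<longlonglongrightarrow> (B o\<^sub>L A)"
  proof -
    have "(id_blinfun - Us n) o\<^sub>L U = (id_blinfun - Us n) o\<^sub>L (((B o\<^sub>L A) - (Bs n o\<^sub>L As n)) o\<^sub>L U)" for n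
      by (rule blinfun_eqI) (simp add: apply_simps)
    moreover have "(\<lambda>n. (id_blinfun - Us n) o\<^sub>L (((B o\<^sub>L A) - (Bs n o\<^sub>L As n)) o\<^sub>L U)) \<longlonglongrightarrow> 0"
      using tendsto_diff[OF tendsto_const BA, of "B o\<^sub>L A"] bU' by (intro null_compose) simp_all
    ultimately show ?thesis by simp
  qed
  \<comment> \<open>Dually, \<open>V A B = V\<close> keeps one term and
    \<open>Bs n (I - Vs n) = 0\<close> kills the other; \<open>V2\<close> again exchanges the
    roles.\<close>
  have V1: "(\<lambda>n. V o\<^sub>L (id_blinfun - Vs n)) \<longlonglongrightarrow> 0" if AB: "(\<lambda>n. As n o\<^sub>L Bs n) \<longlonglongrightarrow> (A o\<^sub>L B)"
  proof -
    have "V o\<^sub>L (id_blinfun - Vs n) = (V o\<^sub>L ((A o\<^sub>L B) - (As n o\<^sub>L Bs n))) o\<^sub>L (id_blinfun - Vs n)" for n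
      by (rule blinfun_eqI) (simp add: apply_simps)
    moreover have "(\<lambda>n. (V o\<^sub>L ((A o\<^sub>L B) - (As n o\<^sub>L Bs n))) o\<^sub>L (id_blinfun - Vs n)) \<longlonglongrightarrow> 0"
      using tendsto_diff[OF tendsto_const AB, of "A o\<^sub>L B"] bV' by (intro null_compose) simp_all
    ultimately show ?thesis by simp
  qed
  have V2: "(\<lambda>n. Vs n o\<^sub>L (id_blinfun - V)) \<longlonglongrightarrow> 0" if AB: "(\<lambda>n. As n o\<^sub>L Bs n) \<longlonglongrightarrow> (A o\<^sub>L B)"
  proof -
    have "Vs n o\<^sub>L (id_blinfun - V) = Vs n o\<^sub>L (((As n o\<^sub>L Bs n) - (A o\<^sub>L B)) o\<^sub>L (id_blinfun - V))" for n
      by (rule blinfun_eqI) (simp add: apply_simps)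
    moreover have "(\<lambda>n. Vs n o\<^sub>L (((As n o\<^sub>L Bs n) - (A o\<^sub>L B)) o\<^sub>L (id_blinfun - V))) \<longlonglongrightarrow> 0"
      using AB bV by (intro null_compose) (simp_all add: LIM_zero)
    ultimately show ?thesis by simp
  qed

  have conv: "Bs \<longlonglongrightarrow> B"
    if "(\<lambda>n. Vs n o\<^sub>L (id_blinfun - V)) \<longlonglongrightarrow> 0" and "(\<lambda>n. (id_blinfun - Us n) o\<^sub>L U) \<longlonglongrightarrow> 0"
  proof (rule tendsto_of_norm_diff_le_self)
    show "(\<lambda>n. norm (Vs n o\<^sub>L (id_blinfun - V)) * norm (id_blinfun - (A o\<^sub>L B))
        + norm (A - As n) * norm B
        + (1 + norm (As n)) * norm ((id_blinfun - Us n) o\<^sub>L U) * norm B) \<longlonglongrightarrow> 0"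
      \<comment> \<open>Each summand has a null factor, and \<open>1 + norm (As n)\<close>
        converges.\<close>
      by (rule tendsto_eq_intros that As refl | simp)+
    show "norm (Bs n - B) \<le> (norm (Vs n o\<^sub>L (id_blinfun - V)) * norm (id_blinfun - (A o\<^sub>L B))
        + norm (A - As n) * norm B
        + (1 + norm (As n)) * norm ((id_blinfun - Us n) o\<^sub>L U) * norm B) * (1 + norm (Bs n))" for n
      by (rule norm_outer_inverse_diff_le[OF B idem(1) assms(13) idem(2) assms(15)
            Bs idem(3) assms(14) idem(4) assms(16)])
  qed

  \<comment> \<open>From (i), both products converge and hence all four gaps vanish. Back to (i)
    through \<open>conv\<close>: (ii) obtains its U gap from \<open>U2\<close>, (iii) its V gap from
    \<open>V2\<close>, and (iv) contains both.\<close>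
  show ?thesis
    unfolding Let_def B_def[symmetric] Bs_def[symmetric]
    using BA AB U1 U2 V1 V2 conv by blast
qed

end
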